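(* Let $q$ be a prime power and $m,n$ positive integers. Suppose $\mathcal{V}\in E_v(q^m,n)$ and $\mathcal{A}\subseteq\mathcal{V}$ is an elementary linear subspace with dimension $a$. Then there are $q^{a(v-a)}$ elementary linear subspaces $\mathcal{B}$ such that $\mathcal{A}\oplus\mathcal{B}=\mathcal{V}$. Furthermore, for given $\mathcal{V}$ and $a$, there are $q^{a(v-a)}{v\brack a}$ such ordered pairs $(\mathcal{A},\mathcal{B})$ (with $\mathcal{A}$ of dimension $a$).
   Context: A $\mathrm{GF}(q^m)$-linear subspace $\mathcal{V}\subseteq \mathrm{GF}(q^m)^n$ is an elementary linear subspace (ELS) if it has a basis consisting of vectors in $\mathrm{GF}(q)^n$. $E_v(q^m,n)$ denotes the set of all ELS's of $\mathrm{GF}(q^m)^n$ with dimension $v$ (over $\mathrm{GF}(q^m)$). $\oplus$ is the (internal) direct sum. ${n\brack u}=\prod_{i=0}^{u-1}\frac{q^n-q^i}{q^u-q^i}$ is the Gaussian binomial coefficient. *)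

theory Defs
  imports "HOL-Analysis.Cartesian_Space" "HOL-Number_Theory.Prime_Powers"
begin

definition is_subfield :: "'a::field set \<Rightarrow> bool" where
  "is_subfield F \<longleftrightarrow> 0 \<in> F \<and> 1 \<in> F \<and>
     (\<forall>x\<in>F. \<forall>y\<in>F. x - y \<in> F \<and> x * y \<in> F) \<and> (\<forall>x\<in>F. inverse x \<in> F)"

definition coords_in :: "'a set \<Rightarrow> ('a ^ 'n) set" where
  "coords_in F = {x. \<forall>i. x $ i \<in> F}"

(* Here 'a is the large field GF(q^m), F its subfield GF(q) and CARD('n) is n.
   Independence, span and dimension are all taken over 'a; only the entries of
   the basis vectors are restricted to F. *)
definition elementary_subspace :: "'a::field set \<Rightarrow> ('a ^ 'n) set \<Rightarrow> bool" where
  "elementary_subspace F V \<longleftrightarrow> vec.subspace V \<and>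
     (\<exists>B. B \<subseteq> coords_in F \<and> vec.independent B \<and> vec.span B = V)"

definition ELS :: "'a::field set \<Rightarrow> nat \<Rightarrow> ('a ^ 'n) set set" where
  "ELS F v = {V. elementary_subspace F V \<and> vec.dim V = v}"

definition is_direct_sum ::
    "('a::field ^ 'n) set \<Rightarrow> ('a ^ 'n) set \<Rightarrow> ('a ^ 'n) set \<Rightarrow> bool" where
  "is_direct_sum A B V \<longleftrightarrow> {x + y | x y. x \<in> A \<and> y \<in> B} = V \<and> A \<inter> B = {0}"

definition gaussian_binomial :: "nat \<Rightarrow> nat \<Rightarrow> nat \<Rightarrow> real" where
  "gaussian_binomial q n u =
     (\<Prod>i<u. (real q ^ n - real q ^ i) / (real q ^ u - real q ^ i))"

end

theory Submission imports Defs begin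

text \<open>
  An elementary subspace \<open>V\<close> of dimension \<open>v\<close> contains exactly \<open>q ^ v\<close> vectors with entries in \<open>F\<close>.
  Hence, for elementary \<open>A \<subseteq> V\<close> of dimension \<open>a\<close>, the lists of \<open>k\<close> such vectors in \<open>V\<close> that are
  independent modulo \<open>A\<close> number \<open>(q ^ v - q ^ a) * \<dots> * (q ^ v - q ^ (a + k - 1))\<close>. Sorting these
  lists by their span \<open>B\<close>, each \<open>B\<close> with \<open>A \<inter> B = {0}\<close> and dimension \<open>k\<close> occurs once for each of its
  \<open>(q ^ k - 1) * \<dots> * (q ^ k - q ^ (k - 1))\<close> ordered bases over \<open>F\<close>. The case \<open>k = v - a\<close> counts
  complements, the case \<open>A = {0}\<close> counts elementary subspaces.
\<close>

section \<open>Subfields and vectors with entries in a subfield\<close>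

lemma is_subfield_zero: "is_subfield F \<Longrightarrow> 0 \<in> F"
  and is_subfield_mult: "is_subfield F \<Longrightarrow> x \<in> F \<Longrightarrow> y \<in> F \<Longrightarrow> x * y \<in> F"
  by (auto simp: is_subfield_def)

lemma is_subfield_add:
  assumes "is_subfield F" "x \<in> F" "y \<in> F"
  shows "x + y \<in> F"
proof -
  have "x - (0 - y) \<in> F"
    using assms unfolding is_subfield_def by blast
  then show ?thesis by simp
qed

lemma is_subfield_sum:
  assumes "is_subfield F" "\<And>i. i \<in> I \<Longrightarrow> f i \<in> F"
  shows "sum f I \<in> F"
  using assms(2)
  by (induction I rule: infinite_finite_induct)
     (auto intro: is_subfield_add is_subfield_zero assms(1))

lemma card_is_subfield_ge_2:
  fixes F :: "'a::{field,finite} set"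
  assumes "is_subfield F"
  shows "2 \<le> card F"
proof -
  have "{0, 1} \<subseteq> F"
    using assms by (simp add: is_subfield_def)
  then have "card {0, 1 :: 'a} \<le> card F"
    by (intro card_mono) auto
  then show ?thesis by simp
qed

lemma card_coords_in:
  "card (coords_in F :: ('a::finite ^ 'n) set) = card F ^ CARD('n)"
proof -
  have "bij_betw vec_nth (coords_in F :: ('a ^ 'n) set) (UNIV \<rightarrow>\<^sub>E F)"
    by (rule bij_betwI[where g = vec_lambda]) (auto simp: coords_in_def)
  then show ?thesis
    by (simp add: bij_betw_same_card card_funcsetE)
qed

text \<open>The standard basis has entries 0 and 1. This fixes the size of a basis of the whole
  space chosen inside \<open>coords_in F\<close>.\<close>

lemma span_coords_in:
  fixes F :: "'a::field set"
  assumes "is_subfield F"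
  shows "vec.span (coords_in F :: ('a ^ 'n) set) = UNIV"
proof -
  have "(cart_basis :: ('a ^ 'n) set) \<subseteq> coords_in F"
    using assms by (auto simp: cart_basis_def coords_in_def axis_def is_subfield_def)
  then show ?thesis
    using vec.span_mono[of cart_basis "coords_in F"] by auto
qed

text \<open>Taking coefficients in \<open>PiE\<close> fixes their value outside \<open>B\<close>, so
  independence gives genuine injectivity. \<open>F\<close> is an arbitrary set here, so that
  \<open>UNIV\<close> can serve as well.\<close>

lemma inj_on_combinations:
  fixes B :: "('a::field ^ 'n) set"
  assumes "vec.independent B"
  shows "inj_on (\<lambda>f. \<Sum>b\<in>B. f b *s b) (B \<rightarrow>\<^sub>E F)"
proof (rule inj_onI)
  fix f g assume fg: "f \<in> B \<rightarrow>\<^sub>E F" "g \<in> B \<rightarrow>\<^sub>E F"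
    and eq: "(\<Sum>b\<in>B. f b *s b) = (\<Sum>b\<in>B. g b *s b)"
  have fin: "finite B" using assms by (rule vec.finiteI_independent)
  have "(\<Sum>b\<in>B. (f b - g b) *s b) = 0"
    using eq by (simp add: vec.scale_left_diff_distrib sum_subtractf)
  then have "\<forall>b\<in>B. f b - g b = 0"
    using vec.independentD[OF assms fin order_refl, of "\<lambda>b. f b - g b"] by blast
  then have "\<And>b. b \<in> B \<Longrightarrow> f b = g b" by simp
  with fg show "f = g"
    by (rule PiE_ext)
qed

lemma combinations_in_coords_in:
  assumes "is_subfield F" "B \<subseteq> coords_in F" "f \<in> B \<rightarrow>\<^sub>E F"
  shows "(\<Sum>b\<in>B. f b *s b) \<in> coords_in F"
  unfolding coords_in_def
  using assms(2,3)
  by (auto simp: coords_in_def sum_component intro!: is_subfield_sum[OF assms(1)] is_subfield_mult[OF assms(1)])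

text \<open>
  Extending \<open>B\<close> to a basis of the whole space inside \<open>coords_in F\<close>, the \<open>F\<close>-combinations of that basis
  exhaust \<open>coords_in F\<close> by cardinality. So independence over \<open>'a\<close> forces the coefficients of a vector
  of \<open>coords_in F\<close> to lie in \<open>F\<close>.
\<close>
lemma representation_in_subfield:
  fixes F :: "'a::{field,finite} set" and B :: "('a ^ 'n) set"
  assumes F: "is_subfield F" and B: "B \<subseteq> coords_in F" "vec.independent B"
    and x: "x \<in> vec.span B" "x \<in> coords_in F" and b: "b \<in> B"
  shows "vec.representation B x b \<in> F"
proof -
  obtain C where C: "B \<subseteq> C" "C \<subseteq> coords_in F" "vec.independent C" "coords_in F \<subseteq> vec.span C"
    using vec.maximal_independent_subset_extend[OF B] .
  have finC: "finite C" using C(3) by (rule vec.finiteI_independent)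
  have "card C = CARD('n)"
    using vec.basis_card_eq_dim[OF C(2,4,3)] span_coords_in[OF F, where 'n = 'n]
    by (metis vec.dim_span vec_dim_card)
  let ?h = "\<lambda>f. \<Sum>b\<in>C. f b *s b"
  have "card (?h ` (C \<rightarrow>\<^sub>E F)) = card (coords_in F :: ('a ^ 'n) set)"
    using \<open>card C = CARD('n)\<close> inj_on_combinations[OF C(3), of F] finC
    by (simp add: card_image card_funcsetE card_coords_in)
  moreover have "?h ` (C \<rightarrow>\<^sub>E F) \<subseteq> coords_in F"
    using combinations_in_coords_in[OF F C(2)] by blast
  ultimately have "?h ` (C \<rightarrow>\<^sub>E F) = coords_in F"
    by (intro card_subset_eq) auto
  then obtain f where f: "f \<in> C \<rightarrow>\<^sub>E F" "x = ?h f"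
    using x(2) by blast
  have xC: "x \<in> vec.span C"
    using x(2) C(4) by blast
  \<comment> \<open>The coefficients of \<open>x\<close> are not yet known to lie in
    \<open>F\<close>, hence uniqueness is applied over \<open>UNIV\<close>; \<open>restrict\<close>
    makes them a member of \<open>PiE\<close>.\<close>
  have "restrict (vec.representation C x) C = f"
  proof (rule inj_onD[OF inj_on_combinations[OF C(3), of UNIV]])
    show "?h (restrict (vec.representation C x) C) = ?h f"
      using vec.sum_representation_eq[OF C(3) xC finC order_refl] f(2) by simp
  qed (use f(1) in auto)
  then have "vec.representation C x b = f b"
    using b C(1) by (metis restrict_apply' subsetD)
  also have "\<dots> \<in> F"
    using f(1) b C(1) by (auto simp: PiE_mem)
  finally show ?thesis
    using vec.representation_extend[OF C(3) x(1) C(1)] by simp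
qed

text \<open>Coordinates over a basis \<open>B\<close> inside \<open>coords_in F\<close> match these
  vectors with the functions from \<open>B\<close> to \<open>F\<close>.\<close>

lemma card_elementary_Int_coords_in:
  fixes F :: "'a::{field,finite} set" and V :: "('a ^ 'n) set"
  assumes F: "is_subfield F" and V: "elementary_subspace F V"
  shows "card (V \<inter> coords_in F) = card F ^ vec.dim V"
proof -
  obtain B where B: "B \<subseteq> coords_in F" "vec.independent B" "vec.span B = V"
    using V unfolding elementary_subspace_def by blast
  have finB: "finite B" using B(2) by (rule vec.finiteI_independent)
  let ?h = "\<lambda>f. \<Sum>b\<in>B. f b *s b"
  have "?h ` (B \<rightarrow>\<^sub>E F) = V \<inter> coords_in F"
  proof (intro equalityI subsetI IntI)
    fix x assume x: "x \<in> V \<inter> coords_in F"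
    then have xB: "x \<in> vec.span B" using B(3) by simp
    have "restrict (vec.representation B x) B \<in> B \<rightarrow>\<^sub>E F"
      using representation_in_subfield[OF F B(1,2) xB] x by auto
    moreover have "x = ?h (restrict (vec.representation B x) B)"
      using vec.sum_representation_eq[OF B(2) xB finB order_refl] by simp
    ultimately show "x \<in> ?h ` (B \<rightarrow>\<^sub>E F)" by blast
  next
    fix x assume "x \<in> ?h ` (B \<rightarrow>\<^sub>E F)"
    then show "x \<in> V"
      using B(3) by (auto intro: vec.span_sum vec.span_scale vec.span_base)
  next
    fix x assume "x \<in> ?h ` (B \<rightarrow>\<^sub>E F)"
    then show "x \<in> coords_in F"
      using combinations_in_coords_in[OF F B(1)] by blast
  qed
  then have "card (V \<inter> coords_in F) = card F ^ card B"
    using card_image[OF inj_on_combinations[OF B(2), of F]] finB by (simp add: card_funcsetE)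
  also have "card B = vec.dim V"
    using vec.dim_span_eq_card_independent[OF B(2)] B(3) by simp
  finally show ?thesis .
qed

section \<open>Building and counting independent lists\<close>

lemma elementary_subspace_span:
  assumes "S \<subseteq> coords_in F"
  shows "elementary_subspace F (vec.span S)"
proof -
  obtain B where "B \<subseteq> S" "vec.independent B" "S \<subseteq> vec.span B"
    using vec.maximal_independent_subset[of S] .
  then have "vec.span B = vec.span S"
    by (metis vec.span_eq vec.span_superset order_trans)
  then show ?thesis
    unfolding elementary_subspace_def
    using \<open>B \<subseteq> S\<close> \<open>vec.independent B\<close> assms by (meson order_trans vec.subspace_span)
qed

text \<open>\<open>A\<close> itself need not lie in \<open>coords_in F\<close>, so it is first
  replaced by a generating set that does.\<close>

lemma elementary_subspace_span_insert:
  assumes "elementary_subspace F A" "x \<in> coords_in F"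
  shows "elementary_subspace F (vec.span (insert x A))"
proof -
  obtain B where B: "B \<subseteq> coords_in F" "vec.span B = A"
    using assms(1) unfolding elementary_subspace_def by blast
  have "vec.span (insert x A) = vec.span (insert x B)"
    using B(2) by (auto simp: vec.span_insert vec.span_span)
  then show ?thesis
    using elementary_subspace_span[of "insert x B" F] B(1) assms(2) by simp
qed

text \<open>
  The dimension condition says that the entries of \<open>xs\<close> are distinct and independent modulo \<open>A\<close>.
\<close>
definition frames :: "'a::field set \<Rightarrow> ('a ^ 'n) set \<Rightarrow> ('a ^ 'n) set \<Rightarrow> nat \<Rightarrow> ('a ^ 'n) list set" where
  "frames F A V k =
     {xs. length xs = k \<and> set xs \<subseteq> V \<inter> coords_in F \<and> vec.dim (A \<union> set xs) = vec.dim A + k}"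

lemma dim_Un_set_le:
  "vec.dim (A \<union> set xs) \<le> vec.dim A + length xs"
proof (induction xs)
  case (Cons x xs)
  then show ?case by (simp add: vec.dim_insert)
qed simp

lemma dim_span_Un: "vec.dim (vec.span S \<union> T) = vec.dim (S \<union> T)"
  by (rule vec.span_eq_dim) (simp add: vec.span_Un vec.span_span)

text \<open>Absorbing the head into \<open>A\<close> leaves the same problem for the tail, which is
  the recursion behind the count.\<close>

lemma Cons_in_frames_iff:
  assumes "vec.subspace A"
  shows "x # xs \<in> frames F A V (Suc k) \<longleftrightarrow>
    x \<in> V \<inter> coords_in F - A \<and> xs \<in> frames F (vec.span (insert x A)) V k"
proof (cases "x \<in> A")
  case True
  \<comment> \<open>A head in \<open>A\<close> adds no dimension, and the \<open>k\<close> remaining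
    entries add at most \<open>k\<close>.\<close>
  then have "A \<union> set (x # xs) = A \<union> set xs" by auto
  then have "length xs = k \<Longrightarrow> vec.dim (A \<union> set (x # xs)) < vec.dim A + Suc k"
    using dim_Un_set_le[of A xs] by simp
  then show ?thesis
    using True by (auto simp: frames_def)
next
  case False
  then have "x \<notin> vec.span A"
    using assms by (metis vec.span_eq_iff)
  then have "vec.dim (insert x A) = Suc (vec.dim A)"
    by (simp add: vec.dim_insert)
  then show ?thesis
    using False dim_span_Un[of "insert x A" "set xs"] by (auto simp: frames_def)
qed

lemma finite_frames: "finite (frames F A (V :: ('a::{field,finite} ^ 'n) set) k)"
  by (rule finite_subset[OF _ finite_lists_length_eq[of UNIV k]]) (auto simp: frames_def)

text \<open>Induction on \<open>k\<close> with \<open>A\<close> varying: the number of tails depends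
  on the head only through the dimension of the enlarged subspace, which is always one more. For
  \<open>k\<close> beyond the codimension of \<open>A\<close> in \<open>V\<close> a factor vanishes,
  as it should.\<close>

lemma card_frames:
  fixes F :: "'a::{field,finite} set" and V :: "('a ^ 'n) set"
  assumes F: "is_subfield F" and V: "elementary_subspace F V"
    and A: "elementary_subspace F A" "A \<subseteq> V"
  shows "card (frames F A V k) = (\<Prod>i<k. card F ^ vec.dim V - card F ^ (vec.dim A + i))"
  using A
proof (induction k arbitrary: A)
  case 0
  have "frames F A V 0 = {[]}" by (auto simp: frames_def)
  then show ?case by simp
next
  case (Suc k)
  let ?D = "V \<inter> coords_in F - A"
  let ?E = "\<lambda>x. vec.span (insert x A)"
  let ?N = "\<Prod>i<k. card F ^ vec.dim V - card F ^ (vec.dim A + Suc i)"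
  have sub: "vec.subspace A" "vec.subspace V"
    using Suc.prems V by (auto simp: elementary_subspace_def)
  have "frames F A V (Suc k) = (\<Union>x\<in>?D. (#) x ` frames F (?E x) V k)"
  proof (intro equalityI subsetI)
    fix ys assume ys: "ys \<in> frames F A V (Suc k)"
    then obtain x xs where "ys = x # xs"
      by (cases ys) (auto simp: frames_def)
    then show "ys \<in> (\<Union>x\<in>?D. (#) x ` frames F (?E x) V k)"
      using ys Cons_in_frames_iff[OF sub(1)] by blast
  qed (use Cons_in_frames_iff[OF sub(1)] in blast)
  then have "card (frames F A V (Suc k)) = (\<Sum>x\<in>?D. card ((#) x ` frames F (?E x) V k))"
    by (simp only:) (rule card_UN_disjoint, auto simp: finite_frames)
  also have "\<dots> = (\<Sum>x\<in>?D. ?N)"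
  proof (rule sum.cong)
    fix x assume x: "x \<in> ?D"
    have "elementary_subspace F (?E x)"
      using elementary_subspace_span_insert[OF Suc.prems(1)] x by blast
    moreover have "?E x \<subseteq> V"
      using x Suc.prems(2) sub(2) by (intro vec.span_minimal) auto
    moreover have "x \<notin> vec.span A"
      using x sub(1) by (metis DiffD2 vec.span_eq_iff)
    then have "vec.dim (?E x) = Suc (vec.dim A)"
      by (simp add: vec.dim_insert)
    ultimately show "card ((#) x ` frames F (?E x) V k) = ?N"
      using Suc.IH[of "?E x"] by (simp add: card_image)
  qed simp
  also have "\<dots> = card ?D * ?N" by simp
  \<comment> \<open>Written as a difference of two sets of vectors over \<open>F\<close>, so that
    the point count applies to \<open>V\<close> and to \<open>A\<close>.\<close>
  also have "?D = V \<inter> coords_in F - A \<inter> coords_in F" by blast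
  also have "card \<dots> = card F ^ vec.dim V - card F ^ vec.dim A"
    using Suc.prems
    by (subst card_Diff_subset)
       (auto simp: card_elementary_Int_coords_in[OF F V] card_elementary_Int_coords_in[OF F Suc.prems(1)])
  finally show ?case
    by (subst prod.lessThan_Suc_shift) simp
qed

lemma elementary_subspace_zero: "elementary_subspace F {0}"
  using elementary_subspace_span[of "{}" F] by simp

lemma card_frames_zero:
  fixes F :: "'a::{field,finite} set" and B :: "('a ^ 'n) set"
  assumes "is_subfield F" "B \<in> ELS F k"
  shows "card (frames F {0} B k) = (\<Prod>i<k. card F ^ k - card F ^ i)"
proof -
  have "elementary_subspace F B" "vec.dim B = k"
    using assms(2) by (auto simp: ELS_def)
  moreover from this have "{0} \<subseteq> B"
    by (simp add: elementary_subspace_def vec.subspace_0)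
  moreover have "vec.dim {0 :: 'a ^ 'n} = 0" by simp
  ultimately show ?thesis
    using card_frames[OF assms(1) _ elementary_subspace_zero, of B k] by simp
qed

section \<open>Sorting the lists by their span\<close>

lemma dim_Un_subspaces:
  assumes "vec.subspace A" "vec.subspace B"
  shows "vec.dim (A \<union> B) + vec.dim (A \<inter> B) = vec.dim A + vec.dim B"
proof -
  have "vec.span (A \<union> B) = {x + y |x y. x \<in> A \<and> y \<in> B}"
    by (simp only: vec.span_Un assms[THEN vec.span_eq_iff[THEN iffD2]])
  then show ?thesis
    using vec.dim_sums_Int[OF assms] vec.dim_span[of "A \<union> B"] by simp
qed

definition disjoint_els :: "'a::field set \<Rightarrow> ('a ^ 'n) set \<Rightarrow> ('a ^ 'n) set \<Rightarrow> nat \<Rightarrow> ('a ^ 'n) set set" where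
  "disjoint_els F A V k = {B \<in> ELS F k. B \<subseteq> V \<and> A \<inter> B = {0}}"

text \<open>The list spans a subspace of \<open>B\<close> of full dimension. Hence it determines
  \<open>B\<close>, which makes the classes of the sorting disjoint.\<close>

lemma span_eq_if_frames_zero:
  assumes "B \<in> ELS F k" "xs \<in> frames F {0} B k"
  shows "vec.span (set xs) = B"
proof -
  have B: "vec.subspace B" "vec.dim B = k"
    using assms(1) by (auto simp: ELS_def elementary_subspace_def)
  have xs: "set xs \<subseteq> B" "vec.dim (insert 0 (set xs)) = k"
    using assms(2) by (auto simp: frames_def)
  then have "vec.dim (set xs) = k"
    by (simp add: vec.dim_insert vec.span_zero)
  then show ?thesis
    using vec.subspace_dim_equal[OF vec.subspace_span B(1), of "set xs"] B xs(1)
    by (simp add: vec.span_minimal)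
qed

lemma frames_eq_UN:
  assumes V: "vec.subspace V" and A: "vec.subspace A"
  shows "frames F A V k = (\<Union>B\<in>disjoint_els F A V k. frames F {0} B k)"
proof (intro equalityI subsetI)
  fix xs assume "xs \<in> frames F A V k"
  then have xs: "length xs = k" "set xs \<subseteq> V" "set xs \<subseteq> coords_in F"
    "vec.dim (A \<union> set xs) = vec.dim A + k"
    by (auto simp: frames_def)
  let ?B = "vec.span (set xs)"
  have "vec.dim (A \<union> ?B) = vec.dim A + k"
    using xs(4) dim_span_Un[of "set xs" A] by (simp add: Un_commute)
  \<comment> \<open>Together with the bound \<open>k\<close> on the dimension of the span, the
    dimension formula forces both a trivial intersection and independence of the list.\<close>
  then have "vec.dim A + k + vec.dim (A \<inter> ?B) = vec.dim A + vec.dim (set xs)"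
    using dim_Un_subspaces[OF A vec.subspace_span, of "set xs"] by simp
  moreover have "vec.dim (set xs) \<le> k"
    using xs(1) vec.dim_le_card'[of "set xs"] card_length[of xs] by simp
  ultimately have dims: "vec.dim (A \<inter> ?B) = 0" "vec.dim (set xs) = k"
    by linarith+
  have "A \<inter> ?B = {0}"
    using dims(1) A by (auto simp: vec.subspace_0 vec.span_zero)
  then have "?B \<in> disjoint_els F A V k"
    using dims(2) elementary_subspace_span[OF xs(3)] vec.span_minimal[OF xs(2) V]
    by (simp add: disjoint_els_def ELS_def)
  moreover have "xs \<in> frames F {0} ?B k"
    using xs dims(2) by (auto simp: frames_def vec.dim_insert vec.span_zero vec.span_base)
  ultimately show "xs \<in> (\<Union>B\<in>disjoint_els F A V k. frames F {0} B k)" by blast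
next
  fix xs assume "xs \<in> (\<Union>B\<in>disjoint_els F A V k. frames F {0} B k)"
  then obtain B where B: "B \<in> ELS F k" "B \<subseteq> V" "A \<inter> B = {0}" and xs: "xs \<in> frames F {0} B k"
    by (auto simp: disjoint_els_def)
  have "vec.dim (A \<union> set xs) = vec.dim (A \<union> B)"
    using dim_span_Un[of "set xs" A] span_eq_if_frames_zero[OF B(1) xs] by (simp add: Un_commute)
  also have "\<dots> = vec.dim A + k"
    using dim_Un_subspaces[OF A, of B] B by (simp add: ELS_def elementary_subspace_def)
  finally show "xs \<in> frames F A V k"
    using xs B(2) by (auto simp: frames_def)
qed

text \<open>Double counting of \<open>frames F A V k\<close> by classes of equal size, kept in
  product form to avoid division of natural numbers.\<close>

lemma card_disjoint_els:
  fixes F :: "'a::{field,finite} set" and V :: "('a ^ 'n) set"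
  assumes F: "is_subfield F" and V: "V \<in> ELS F v" and A: "A \<in> ELS F a" "A \<subseteq> V"
  shows "card (disjoint_els F A V k) * (\<Prod>i<k. card F ^ k - card F ^ i) =
    (\<Prod>i<k. card F ^ v - card F ^ (a + i))"
proof -
  have "vec.subspace V" "vec.subspace A"
    using V A by (auto simp: ELS_def elementary_subspace_def)
  then have "card (frames F A V k) = card (\<Union>B\<in>disjoint_els F A V k. frames F {0} B k)"
    by (simp add: frames_eq_UN)
  also have "\<dots> = (\<Sum>B\<in>disjoint_els F A V k. card (frames F {0} B k))"
  proof (rule card_UN_disjoint)
    have "B = C" if "B \<in> disjoint_els F A V k" "C \<in> disjoint_els F A V k"
      "xs \<in> frames F {0} B k" "xs \<in> frames F {0} C k" for B C xs
    proof -
      have "B \<in> ELS F k" "C \<in> ELS F k"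
        using that by (auto simp: disjoint_els_def)
      then show ?thesis
        using span_eq_if_frames_zero that(3,4) by metis
    qed
    then show "\<forall>B\<in>disjoint_els F A V k. \<forall>C\<in>disjoint_els F A V k. B \<noteq> C \<longrightarrow>
        frames F {0} B k \<inter> frames F {0} C k = {}"
      by blast
  qed (auto simp: finite_frames)
  also have "\<dots> = (\<Sum>B\<in>disjoint_els F A V k. \<Prod>i<k. card F ^ k - card F ^ i)"
    by (rule sum.cong) (auto simp: disjoint_els_def card_frames_zero[OF F])
  also have "\<dots> = card (disjoint_els F A V k) * (\<Prod>i<k. card F ^ k - card F ^ i)"
    by simp
  finally show ?thesis
    using card_frames[OF F, of V A k] V A by (simp add: ELS_def)
qed

section \<open>Complements, subspaces and pairs\<close>

lemma prod_power_diff_pos: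
  fixes q :: nat
  assumes "2 \<le> q"
  shows "0 < (\<Prod>i<k. q ^ k - q ^ i)"
  using assms by (auto intro!: prod_pos simp: power_strict_increasing)

text \<open>The intersection clause puts 0 into both summands, so each vector of one summand is
  itself a sum.\<close>

lemma is_direct_sum_subset:
  assumes "is_direct_sum A B V"
  shows "A \<subseteq> V" "B \<subseteq> V"
proof -
  have zero: "0 \<in> A" "0 \<in> B" and V: "V = {x + y | x y. x \<in> A \<and> y \<in> B}"
    using assms by (auto simp: is_direct_sum_def)
  show "A \<subseteq> V"
  proof
    fix x assume "x \<in> A"
    then have "x + 0 \<in> V"
      unfolding V using zero(2) by blast
    then show "x \<in> V" by simp
  qed
  show "B \<subseteq> V"
  proof
    fix y assume "y \<in> B"
    then have "0 + y \<in> V"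
      unfolding V using zero(1) by blast
    then show "y \<in> V" by simp
  qed
qed

text \<open>The dimension formula gives the dimension of a complement and, conversely, shows that a
  disjoint \<open>B\<close> of that dimension fills up \<open>V\<close>.\<close>

lemma direct_sum_iff_disjoint_els:
  assumes V: "V \<in> ELS F v" and A: "A \<in> ELS F a" "A \<subseteq> V"
  shows "elementary_subspace F B \<and> is_direct_sum A B V \<longleftrightarrow> B \<in> disjoint_els F A V (v - a)"
proof -
  have sub: "vec.subspace V" "vec.subspace A" and dims: "vec.dim V = v" "vec.dim A = a"
    using V A by (auto simp: ELS_def elementary_subspace_def)
  have le: "a \<le> v"
    using vec.dim_subset[OF A(2)] dims by simp
  show ?thesis
  proof
    assume B: "elementary_subspace F B \<and> is_direct_sum A B V"
    then have subB: "vec.subspace B"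
      by (simp add: elementary_subspace_def)
    have "vec.dim B = v - a"
      using vec.dim_sums_Int[OF sub(2) subB] B dims by (simp add: is_direct_sum_def)
    moreover have "B \<subseteq> V"
      using B is_direct_sum_subset(2) by blast
    ultimately show "B \<in> disjoint_els F A V (v - a)"
      using B by (simp add: disjoint_els_def ELS_def is_direct_sum_def)
  next
    assume "B \<in> disjoint_els F A V (v - a)"
    then have B: "elementary_subspace F B" "vec.dim B = v - a" "B \<subseteq> V" "A \<inter> B = {0}"
      by (auto simp: disjoint_els_def ELS_def)
    have subB: "vec.subspace B"
      using B(1) by (simp add: elementary_subspace_def)
    have "{x + y | x y. x \<in> A \<and> y \<in> B} = V"
    proof (rule vec.subspace_dim_equal)
      show "vec.subspace {x + y | x y. x \<in> A \<and> y \<in> B}"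
        by (rule vec.subspace_sums[OF sub(2) subB])
      show "{x + y | x y. x \<in> A \<and> y \<in> B} \<subseteq> V"
        using A(2) B(3) by (auto intro: vec.subspace_add[OF sub(1)])
      show "vec.dim V \<le> vec.dim {x + y | x y. x \<in> A \<and> y \<in> B}"
        using vec.dim_sums_Int[OF sub(2) subB] B dims le by simp
    qed (rule sub(1))
    then show "elementary_subspace F B \<and> is_direct_sum A B V"
      using B by (simp add: is_direct_sum_def)
  qed
qed

lemma card_complements:
  fixes F :: "'a::{field,finite} set" and V :: "('a ^ 'n) set"
  assumes F: "is_subfield F" and V: "V \<in> ELS F v" and A: "A \<in> ELS F a" "A \<subseteq> V"
  shows "card {B. elementary_subspace F B \<and> is_direct_sum A B V} = card F ^ (a * (v - a))"
proof -
  let ?P = "\<Prod>i<v - a. card F ^ (v - a) - card F ^ i"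
  have le: "a \<le> v"
    using vec.dim_subset[OF A(2)] A(1) V by (simp add: ELS_def)
  have "card (disjoint_els F A V (v - a)) * ?P = (\<Prod>i<v - a. card F ^ v - card F ^ (a + i))"
    by (rule card_disjoint_els[OF assms])
  \<comment> \<open>As \<open>a\<close> \<le> \<open>v\<close>, a factor \<open>q ^ a\<close> splits
    off each term; what remains is the number of ordered bases, which cancels.\<close>
  also have "\<dots> = (\<Prod>i<v - a. card F ^ a * (card F ^ (v - a) - card F ^ i))"
    using le by (simp add: diff_mult_distrib2 power_add[symmetric])
  also have "\<dots> = card F ^ (a * (v - a)) * ?P"
    by (simp add: prod.distrib power_mult)
  finally have "card (disjoint_els F A V (v - a)) = card F ^ (a * (v - a))"
    using prod_power_diff_pos[OF card_is_subfield_ge_2[OF F], of "v - a"]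
    by (metis mult_right_cancel less_irrefl)
  then show ?thesis
    using direct_sum_iff_disjoint_els[OF V A] by simp
qed

lemma card_elementary_subspaces:
  fixes F :: "'a::{field,finite} set" and V :: "('a ^ 'n) set"
  assumes F: "is_subfield F" and V: "V \<in> ELS F v"
  shows "real (card {A \<in> ELS F a. A \<subseteq> V}) = gaussian_binomial (card F) v a"
proof -
  let ?q = "card F" and ?S = "{A \<in> ELS F a. A \<subseteq> V}"
  have q: "2 \<le> ?q"
    by (rule card_is_subfield_ge_2[OF F])
  have sub: "vec.subspace W" if "W \<in> ELS F k" for W :: "('a ^ 'n) set" and k
    using that by (simp add: ELS_def elementary_subspace_def)
  have zero: "{0} \<in> ELS F 0" "{0} \<subseteq> V"
    using vec.subspace_0[OF sub[OF V]] elementary_subspace_zero by (auto simp: ELS_def)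
  \<comment> \<open>Every subspace meets \<open>{0}\<close> in \<open>{0}\<close>, so the
    disjointness condition is automatic.\<close>
  have "?S = disjoint_els F {0} V a"
    using vec.subspace_0[OF sub] by (auto simp: disjoint_els_def)
  then have *: "card ?S * (\<Prod>i<a. ?q ^ a - ?q ^ i) = (\<Prod>i<a. ?q ^ v - ?q ^ i)"
    using card_disjoint_els[OF F V zero, of a] by simp
  have den: "real (\<Prod>i<a. ?q ^ a - ?q ^ i) = (\<Prod>i<a. real ?q ^ a - real ?q ^ i)"
    using q by (auto simp: of_nat_diff power_increasing intro!: prod.cong)
  \<comment> \<open>For \<open>a\<close> > \<open>v\<close> the truncated differences no longer
    agree with the real ones, but both products contain the zero factor at
    \<open>i = v\<close>.\<close>
  have num: "real (\<Prod>i<a. ?q ^ v - ?q ^ i) = (\<Prod>i<a. real ?q ^ v - real ?q ^ i)"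
  proof (cases "a \<le> v")
    case True
    then show ?thesis
      using q by (auto simp: of_nat_diff power_increasing intro!: prod.cong)
  next
    case False
    then have "v \<in> {..<a}" by simp
    then have "(\<Prod>i<a. ?q ^ v - ?q ^ i) = 0" "(\<Prod>i<a. real ?q ^ v - real ?q ^ i) = 0"
      by (auto intro!: prod_zero bexI[of _ v])
    then show ?thesis by (simp only: of_nat_0)
  qed
  have "real (card ?S) * (\<Prod>i<a. real ?q ^ a - real ?q ^ i) = (\<Prod>i<a. real ?q ^ v - real ?q ^ i)"
    by (simp only: * den[symmetric] num[symmetric] of_nat_mult[symmetric])
  moreover have "(\<Prod>i<a. real ?q ^ a - real ?q ^ i) \<noteq> 0"
    using prod_power_diff_pos[OF q, of a]
    by (simp only: den[symmetric] of_nat_eq_0_iff neq0_conv not_False_eq_True)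
  ultimately show ?thesis
    by (simp add: gaussian_binomial_def prod_dividef field_simps)
qed

theorem lemma2:
  fixes F :: "'a::{field,finite} set" and V :: "('a ^ 'n) set" and q m v a :: nat
  assumes "primepow q" and "m > 0"
    and "CARD('a) = q ^ m"
    and "is_subfield F" and "card F = q"
    and "V \<in> ELS F v"
  shows "(\<forall>A \<in> ELS F a. A \<subseteq> V \<longrightarrow>
            card {B. elementary_subspace F B \<and> is_direct_sum A B V} = q ^ (a * (v - a))) \<and>
         real (card {(A, B). A \<in> ELS F a \<and> elementary_subspace F B \<and> is_direct_sum A B V})
           = real q ^ (a * (v - a)) * gaussian_binomial q v a"
proof -
  let ?C = "\<lambda>A. {B. elementary_subspace F B \<and> is_direct_sum A B V}"
  let ?S = "{A \<in> ELS F a. A \<subseteq> V}"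
  have complements: "card (?C A) = q ^ (a * (v - a))" if "A \<in> ?S" for A
    using card_complements[of F V v A a] that assms by simp
  \<comment> \<open>A direct sum forces \<open>A\<close> into \<open>V\<close>, so the pairs fibre
    over \<open>?S\<close> with fibres of constant size.\<close>
  have "{(A, B). A \<in> ELS F a \<and> elementary_subspace F B \<and> is_direct_sum A B V} = (SIGMA A:?S. ?C A)"
    using is_direct_sum_subset(1) by blast
  then have "card {(A, B). A \<in> ELS F a \<and> elementary_subspace F B \<and> is_direct_sum A B V} =
      q ^ (a * (v - a)) * card ?S"
    using complements by (simp add: card_SigmaI)
  then show ?thesis
    using complements card_elementary_subspaces[of F V v a] assms by simp
qed

end
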